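(* Let $f:\mathbb{R}^d\to\mathbb{R}$ be $L$-smooth and $\mu$-strongly convex (with $\mu>0$), and let $\psi:\mathbb{R}^d\to\mathbb{R}\cup\{+\infty\}$ be proper, closed and convex. Let $x_\star$ be the unique minimizer of $f+\psi$ and $h_\star := \nabla f(x_\star)$. Let $0<\gamma\le \frac1L$ and $0<p\le 1$, and let $(x_t,h_t)_{t\ge 0}$ be the iterates of the ProxSkip algorithm with stepsize $\gamma$, probability $p$ and arbitrary initial $x_0,h_0\in\mathbb{R}^d$. Define $$\Psi_t := \|x_t-x_\star\|^2+\frac{\gamma^2}{p^2}\|h_t-h_\star\|^2 .$$ Then for every $T\ge 1$, $$\mathbb{E}[\Psi_T]\le (1-\zeta)^T\,\Psi_0,\qquad \text{where } \zeta:=\min\{\gamma\mu,\,p^2\}.$$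
   Context: $\|\cdot\|$ is the Euclidean norm. $f$ is $L$-smooth if it is differentiable with $L$-Lipschitz gradient. For $\eta>0$, $\mathrm{prox}_{\eta\psi}(x):=\arg\min_{y\in\mathbb{R}^d}\left[\frac12\|y-x\|^2+\eta\psi(y)\right]$. ProxSkip algorithm (stepsize $\gamma>0$, probability $p\in(0,1]$, initial $x_0,h_0\in\mathbb{R}^d$). Let $\theta_0,\theta_1,\dots$ be independent $\{0,1\}$-valued random variables with $\mathrm{Prob}(\theta_t=1)=p$. For $t=0,1,2,\dots$: - $\hat x_{t+1}=x_t-\gamma(\nabla f(x_t)-h_t)$; - if $\theta_t=1$: $x_{t+1}=\mathrm{prox}_{\frac{\gamma}{p}\psi}\left(\hat x_{t+1}-\frac{\gamma}{p}h_t\right)$; if $\theta_t=0$: $x_{t+1}=\hat x_{t+1}$; - $h_{t+1}=h_t+\frac{p}{\gamma}(x_{t+1}-\hat x_{t+1})$. *)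

theory Defs
  imports "HOL-Probability.Probability"
begin

definition grad :: "('a::real_inner \<Rightarrow> real) \<Rightarrow> 'a \<Rightarrow> 'a" where
  "grad f x = (THE g. GDERIV f x :> g)"

definition smooth_fun :: "real \<Rightarrow> ('a::real_inner \<Rightarrow> real) \<Rightarrow> bool" where
  "smooth_fun L f \<longleftrightarrow> (\<forall>x. f differentiable (at x)) \<and> L-lipschitz_on UNIV (grad f)"

definition strongly_convex_fun :: "real \<Rightarrow> ('a::real_inner \<Rightarrow> real) \<Rightarrow> bool" where
  "strongly_convex_fun \<mu> f \<longleftrightarrow>
     (\<forall>x y. \<forall>t\<in>{0..1}. f (t *\<^sub>R x + (1 - t) *\<^sub>R y)
        \<le> t * f x + (1 - t) * f y - \<mu> / 2 * t * (1 - t) * (norm (x - y))\<^sup>2)"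

text \<open>The library's \<^const>\<open>epigraph\<close> is restricted to real-valued functions.\<close>

definition ext_epigraph :: "('a \<Rightarrow> ereal) \<Rightarrow> ('a \<times> real) set" where
  "ext_epigraph \<psi> = {(x, r). \<psi> x \<le> ereal r}"

definition proper_fun :: "('a \<Rightarrow> ereal) \<Rightarrow> bool" where
  "proper_fun \<psi> \<longleftrightarrow> (\<forall>x. \<psi> x \<noteq> -\<infinity>) \<and> (\<exists>x. \<psi> x \<noteq> \<infinity>)"

definition closed_fun :: "('a::topological_space \<Rightarrow> ereal) \<Rightarrow> bool" where
  "closed_fun \<psi> \<longleftrightarrow> closed (ext_epigraph \<psi>)"

definition convex_fun :: "('a::real_vector \<Rightarrow> ereal) \<Rightarrow> bool" where
  "convex_fun \<psi> \<longleftrightarrow> convex (ext_epigraph \<psi>)"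

text \<open>\<^const>\<open>arg_min\<close> picks some minimizer. For proper, closed and convex \<open>\<psi>\<close> and \<open>\<eta> > 0\<close> the
  objective below has exactly one.\<close>

definition prox :: "real \<Rightarrow> ('a::real_inner \<Rightarrow> ereal) \<Rightarrow> 'a \<Rightarrow> 'a" where
  "prox \<eta> \<psi> x = (ARG_MIN (\<lambda>y. ereal (1 / 2 * (norm (y - x))\<^sup>2) + ereal \<eta> * \<psi> y) y. True)"

definition proxskip_step ::
  "('a::real_inner \<Rightarrow> real) \<Rightarrow> ('a \<Rightarrow> ereal) \<Rightarrow> real \<Rightarrow> real \<Rightarrow> bool \<Rightarrow> 'a \<times> 'a \<Rightarrow> 'a \<times> 'a" where
  "proxskip_step f \<psi> \<gamma> p coin = (\<lambda>(x, h).
     let xhat = x - \<gamma> *\<^sub>R (grad f x - h);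
         x' = (if coin then prox (\<gamma> / p) \<psi> (xhat - (\<gamma> / p) *\<^sub>R h) else xhat);
         h' = h + (p / \<gamma>) *\<^sub>R (x' - xhat)
     in (x', h'))"

text \<open>The pair \<open>(x\<^sub>t, h\<^sub>t)\<close> along one realization \<open>coins\<close> of the coin flips; the entry
  \<open>coins t\<close> decides whether step \<open>t\<close> evaluates the proximity operator.\<close>

primrec proxskip ::
  "('a::real_inner \<Rightarrow> real) \<Rightarrow> ('a \<Rightarrow> ereal) \<Rightarrow> real \<Rightarrow> real \<Rightarrow> 'a \<Rightarrow> 'a \<Rightarrow>
     (nat \<Rightarrow> bool) \<Rightarrow> nat \<Rightarrow> 'a \<times> 'a" where
  "proxskip f \<psi> \<gamma> p x0 h0 coins 0 = (x0, h0)"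
| "proxskip f \<psi> \<gamma> p x0 h0 coins (Suc t) =
     proxskip_step f \<psi> \<gamma> p (coins t) (proxskip f \<psi> \<gamma> p x0 h0 coins t)"

definition lyapunov :: "real \<Rightarrow> real \<Rightarrow> 'a::real_inner \<Rightarrow> 'a \<Rightarrow> 'a \<times> 'a \<Rightarrow> real" where
  "lyapunov \<gamma> p xstar hstar = (\<lambda>(x, h).
     (norm (x - xstar))\<^sup>2 + \<gamma>\<^sup>2 / p\<^sup>2 * (norm (h - hstar))\<^sup>2)"

end

theory Submission
  imports Defs
begin

text \<open>Write \<open>X = x\<^sub>t - \<gamma> (\<nabla>f(x\<^sub>t) - h\<^sub>t) - x\<^sub>\<star>\<close>, \<open>H = h\<^sub>t - h\<^sub>\<star>\<close> and \<open>c = \<gamma> / p\<close>. After a prox step,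
  \<open>-h\<^sub>t\<^sub>+\<^sub>1\<close> is a subgradient of \<open>\<psi>\<close> at \<open>x\<^sub>t\<^sub>+\<^sub>1\<close>, as \<open>-h\<^sub>\<star>\<close> is at \<open>x\<^sub>\<star>\<close>, so monotonicity of the
  subdifferential bounds the new Lyapunov value by \<open>\<parallel>X - c H\<parallel>\<^sup>2\<close>; without a prox step it equals
  \<open>\<parallel>X\<parallel>\<^sup>2 + c\<^sup>2 \<parallel>H\<parallel>\<^sup>2\<close>. Averaging with weights \<open>p\<close> and \<open>1 - p\<close> gives
  \<open>\<parallel>X - \<gamma> H\<parallel>\<^sup>2 + (1 - p\<^sup>2) c\<^sup>2 \<parallel>H\<parallel>\<^sup>2\<close>, and \<open>X - \<gamma> H\<close> is the difference of the gradient steps from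
  \<open>x\<^sub>t\<close> and \<open>x\<^sub>\<star>\<close>, which contracts by cocoercivity of \<open>\<nabla>f\<close>.\<close>

subsection \<open>Gradients of smooth strongly convex functions\<close>

lemma GDERIV_unique:
  fixes f :: "'a::euclidean_space \<Rightarrow> real"
  assumes "GDERIV f x :> d" and "GDERIV f x :> e"
  shows "d = e"
proof -
  have "(\<lambda>h. inner h d) = (\<lambda>h. inner h e)"
    using assms unfolding gderiv_def by (rule has_derivative_unique)
  then have "inner d b = inner e b" for b
    by (metis inner_commute)
  then show ?thesis
    by (rule euclidean_eqI)
qed

text \<open>Riesz representation gives existence: the linear functional \<open>f'\<close> is the
  inner product with \<open>adjoint f' 1\<close>. With uniqueness, the definite description in
  \<open>grad\<close> denotes this vector.\<close>

lemma GDERIV_grad: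
  fixes f :: "'a::euclidean_space \<Rightarrow> real"
  assumes "f differentiable (at x)"
  shows "GDERIV f x :> grad f x"
proof -
  obtain f' where f': "(f has_derivative f') (at x)"
    using assms unfolding differentiable_def by blast
  then have "linear f'"
    by (rule has_derivative_linear)
  then have "f' = (\<lambda>h. inner h (adjoint f' 1))"
    using adjoint_works[of f' _ 1] by (simp add: fun_eq_iff)
  then have "GDERIV f x :> adjoint f' 1"
    unfolding gderiv_def using f' by simp
  then show ?thesis
    unfolding grad_def by (metis (mono_tags, lifting) GDERIV_unique theI)
qed

lemma GDERIV_along_line:
  fixes f :: "'a::real_inner \<Rightarrow> real"
  assumes "GDERIV f (x + t *\<^sub>R d) :> g"
  shows "((\<lambda>s. f (x + s *\<^sub>R d)) has_real_derivative inner d g) (at t)"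
proof -
  have "((\<lambda>s. x + s *\<^sub>R d) has_derivative (\<lambda>s. s *\<^sub>R d)) (at t)"
    by (auto intro!: derivative_eq_intros)
  then have "((\<lambda>s. f (x + s *\<^sub>R d)) has_derivative (\<lambda>s. inner (s *\<^sub>R d) g)) (at t)"
    using assms unfolding gderiv_def by (rule has_derivative_compose)
  then show ?thesis
    unfolding has_field_derivative_def
    by (rule has_derivative_eq_rhs) (simp add: fun_eq_iff)
qed

text \<open>The limit is taken from the right because convexity gives information only for
  \<open>t\<close> between 0 and 1; both first-order arguments below pass to this limit.\<close>

lemma GDERIV_quotient_tendsto:
  fixes f :: "'a::real_inner \<Rightarrow> real"
  assumes "GDERIV f x :> g"
  shows "((\<lambda>t. (f (x + t *\<^sub>R d) - f x) / t) \<longlongrightarrow> inner g d) (at_right 0)"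
proof -
  have "((\<lambda>s. f (x + s *\<^sub>R d)) has_real_derivative inner d g) (at 0)"
    using assms by (intro GDERIV_along_line) simp
  then have "((\<lambda>t. (f (x + t *\<^sub>R d) - f x) / t) \<longlongrightarrow> inner g d) (at 0)"
    by (simp add: DERIV_def inner_commute)
  then show ?thesis
    by (rule tendsto_mono[rotated]) (simp add: at_le)
qed

text \<open>Strong convexity on the segment from \<open>x\<close> to \<open>y\<close>, divided by
  \<open>t\<close>, bounds the difference quotient \<open>?q t\<close> by \<open>?b t\<close>; then
  \<open>t\<close> tends to 0.\<close>

lemma strongly_convex_fun_gradient_ineq:
  fixes f :: "'a::real_inner \<Rightarrow> real"
  assumes "strongly_convex_fun \<mu> f" and "GDERIV f x :> g"
  shows "f x + inner g (y - x) + \<mu> / 2 * (norm (y - x))\<^sup>2 \<le> f y"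
proof -
  let ?q = "\<lambda>t. (f (x + t *\<^sub>R (y - x)) - f x) / t"
  let ?b = "\<lambda>t. f y - f x - \<mu> / 2 * (1 - t) * (norm (y - x))\<^sup>2"
  have q: "(?q \<longlongrightarrow> inner g (y - x)) (at_right 0)"
    using assms(2) by (rule GDERIV_quotient_tendsto)
  have b: "(?b \<longlongrightarrow> f y - f x - \<mu> / 2 * (1 - 0) * (norm (y - x))\<^sup>2) (at_right 0)"
    by (intro tendsto_intros)
  have "eventually (\<lambda>t. t \<in> {0<..<1::real}) (at_right 0)"
    by (rule eventually_at_right_real) simp
  then have "eventually (\<lambda>t. ?q t \<le> ?b t) (at_right 0)"
  proof eventually_elim
    case (elim t)
    have "f (t *\<^sub>R y + (1 - t) *\<^sub>R x)
        \<le> t * f y + (1 - t) * f x - \<mu> / 2 * t * (1 - t) * (norm (y - x))\<^sup>2"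
      using assms(1) elim unfolding strongly_convex_fun_def by auto
    moreover have "t *\<^sub>R y + (1 - t) *\<^sub>R x = x + t *\<^sub>R (y - x)"
      by (simp add: algebra_simps)
    ultimately have "f (x + t *\<^sub>R (y - x)) - f x \<le> ?b t * t"
      by (simp add: algebra_simps)
    then show ?case
      using elim by (simp add: pos_divide_le_eq)
  qed
  then have "inner g (y - x) \<le> f y - f x - \<mu> / 2 * (1 - 0) * (norm (y - x))\<^sup>2"
    by (rule tendsto_le[OF _ b q, rotated]) simp
  then show ?thesis
    by simp
qed

text \<open>The descent lemma, obtained from monotonicity rather than an integral: by Cauchy-Schwarz
  and the Lipschitz bound, \<open>?\<phi>\<close> has nonpositive derivative on the unit
  interval.\<close>

lemma smooth_fun_quadratic_upper_bound:
  fixes f :: "'a::euclidean_space \<Rightarrow> real"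
  assumes "smooth_fun L f"
  shows "f (x + d) \<le> f x + inner (grad f x) d + L / 2 * (norm d)\<^sup>2"
proof -
  let ?\<phi> = "\<lambda>t. f (x + t *\<^sub>R d) - t * inner d (grad f x) - L / 2 * t\<^sup>2 * (norm d)\<^sup>2"
  have "\<exists>y. DERIV ?\<phi> t :> y \<and> y \<le> 0" if "0 \<le> t" "t \<le> 1" for t
  proof (intro exI conjI)
    have "GDERIV f (x + t *\<^sub>R d) :> grad f (x + t *\<^sub>R d)"
      using assms unfolding smooth_fun_def by (intro GDERIV_grad) simp
    from GDERIV_along_line[OF this]
    show "DERIV ?\<phi> t :> inner d (grad f (x + t *\<^sub>R d)) - inner d (grad f x) - L * t * (norm d)\<^sup>2"
      by (auto intro!: derivative_eq_intros)
    have "inner d (grad f (x + t *\<^sub>R d)) - inner d (grad f x)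
        \<le> norm d * norm (grad f (x + t *\<^sub>R d) - grad f x)"
      by (metis inner_diff_right norm_cauchy_schwarz)
    also have "norm (grad f (x + t *\<^sub>R d) - grad f x) \<le> L * (t * norm d)"
      using assms that lipschitz_onD[of L UNIV "grad f" "x + t *\<^sub>R d" x]
      unfolding smooth_fun_def by (simp add: dist_norm)
    finally have "inner d (grad f (x + t *\<^sub>R d)) - inner d (grad f x) \<le> norm d * (L * (t * norm d))"
      by (simp add: mult_left_mono)
    then show "inner d (grad f (x + t *\<^sub>R d)) - inner d (grad f x) - L * t * (norm d)\<^sup>2 \<le> 0"
      by (simp add: power2_eq_square algebra_simps)
  qed
  then have "?\<phi> 1 \<le> ?\<phi> 0"
    by (rule DERIV_nonpos_imp_nonincreasing[rotated]) simp_all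
  then show ?thesis
    by (simp add: inner_commute)
qed

text \<open>The auxiliary function \<open>z \<mapsto> f z - \<nabla>f(x) \<bullet> z\<close> is minimal at \<open>x\<close>; the point \<open>z\<close> below is a
  gradient step of length \<open>1 / L\<close> for it, started at \<open>y\<close>.\<close>

lemma smooth_convex_gradient_gap:
  fixes f :: "'a::euclidean_space \<Rightarrow> real"
  assumes "smooth_fun L f" and "strongly_convex_fun \<mu> f" and "0 \<le> \<mu>" and "0 < L"
  shows "f x + inner (grad f x) (y - x) + 1 / (2 * L) * (norm (grad f y - grad f x))\<^sup>2 \<le> f y"
proof -
  define r where "r = grad f y - grad f x"
  define z where "z = y + (- (1 / L)) *\<^sub>R r"
  have "GDERIV f x :> grad f x"
    using assms(1) unfolding smooth_fun_def by (intro GDERIV_grad) simp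
  from strongly_convex_fun_gradient_ineq[OF assms(2) this, of z]
  have "f x + inner (grad f x) (z - x) \<le> f z"
    using assms(3) by (smt (verit) mult_nonneg_nonneg zero_le_power2 divide_nonneg_nonneg)
  also have "f z \<le> f y - 1 / L * inner (grad f y) r + 1 / (2 * L) * (norm r)\<^sup>2"
    using smooth_fun_quadratic_upper_bound[OF assms(1), of y "(- (1 / L)) *\<^sub>R r"] assms(4)
    unfolding z_def by (simp add: power_mult_distrib power_divide power2_eq_square)
  also have "inner (grad f y) r = inner (grad f x) r + (norm r)\<^sup>2"
    unfolding r_def power2_norm_eq_inner by (simp add: inner_diff_left)
  finally show ?thesis
    using assms(4) unfolding z_def r_def[symmetric]
    by (simp add: algebra_simps inner_diff_right inner_add_right add_divide_distrib)
qed

text \<open>Adding the gap inequality to its copy with \<open>x\<close> and \<open>y\<close>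
  exchanged cancels the function values, and the two terms with \<open>1 / (2 * L)\<close> add up to
  \<open>1 / L\<close>.\<close>

lemma smooth_convex_cocoercive:
  fixes f :: "'a::euclidean_space \<Rightarrow> real"
  assumes "smooth_fun L f" and "strongly_convex_fun \<mu> f" and "0 \<le> \<mu>" and "0 < L"
  shows "(norm (grad f x - grad f y))\<^sup>2 \<le> L * inner (grad f x - grad f y) (x - y)"
proof -
  have "1 / L * (norm (grad f x - grad f y))\<^sup>2 \<le> inner (grad f x - grad f y) (x - y)"
    using smooth_convex_gradient_gap[OF assms, of x y] smooth_convex_gradient_gap[OF assms, of y x]
    by (simp add: algebra_simps inner_diff_right inner_diff_left norm_minus_commute)
  then show ?thesis
    using assms(4) by (simp add: field_simps)
qed

lemma norm_diff_scaleR_squared: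
  fixes x y :: "'a::real_inner"
  shows "(norm (x - a *\<^sub>R y))\<^sup>2 = (norm x)\<^sup>2 - 2 * a * inner x y + a\<^sup>2 * (norm y)\<^sup>2"
  unfolding power2_norm_eq_inner
  by (simp add: inner_diff_left inner_diff_right inner_commute[of y x] power2_eq_square algebra_simps)

text \<open>The expanded square contains \<open>- 2 * \<gamma> * inner g (x - y)\<close>.
  Cocoercivity spends one half of it on the quadratic term in \<open>g\<close>; strong monotonicity
  turns the other half into the contraction.\<close>

lemma gradient_step_contraction:
  fixes f :: "'a::euclidean_space \<Rightarrow> real"
  assumes "smooth_fun L f" and "strongly_convex_fun \<mu> f" and "0 \<le> \<mu>"
    and "0 < \<gamma>" and "\<gamma> \<le> 1 / L"
  shows "(norm ((x - \<gamma> *\<^sub>R grad f x) - (y - \<gamma> *\<^sub>R grad f y)))\<^sup>2 \<le> (1 - \<gamma> * \<mu>) * (norm (x - y))\<^sup>2"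
proof -
  define g where "g = grad f x - grad f y"
  \<comment> \<open>Since \<open>1 / 0 = 0\<close>, the bound \<open>\<gamma> \<le> 1 / L\<close>
    with positive \<open>\<gamma>\<close> excludes \<open>L = 0\<close> as well as negative
    \<open>L\<close>.\<close>
  have L: "0 < L"
    using assms(4,5) by (metis less_le_trans zero_less_divide_1_iff)
  have G: "GDERIV f z :> grad f z" for z
    using assms(1) unfolding smooth_fun_def by (intro GDERIV_grad) simp
  have mono: "\<mu> * (norm (x - y))\<^sup>2 \<le> inner g (x - y)"
    using strongly_convex_fun_gradient_ineq[OF assms(2) G[of x], of y]
      strongly_convex_fun_gradient_ineq[OF assms(2) G[of y], of x]
    unfolding g_def
    by (simp add: algebra_simps inner_diff_right inner_diff_left norm_minus_commute)
  have "\<gamma> * (norm g)\<^sup>2 \<le> \<gamma> * (L * inner g (x - y))"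
    using smooth_convex_cocoercive[OF assms(1-3) L, of x y] assms(4)
    unfolding g_def by (intro mult_left_mono) auto
  also have "\<dots> = (\<gamma> * L) * inner g (x - y)"
    by simp
  also have "\<dots> \<le> 1 * inner g (x - y)"
  proof (intro mult_right_mono)
    show "\<gamma> * L \<le> 1"
      using assms(5) L by (simp add: pos_le_divide_eq)
    show "0 \<le> inner g (x - y)"
      using mono assms(3) by (smt (verit) mult_nonneg_nonneg zero_le_power2)
  qed
  finally have coco: "\<gamma> * (norm g)\<^sup>2 \<le> inner g (x - y)"
    by simp
  have "(x - \<gamma> *\<^sub>R grad f x) - (y - \<gamma> *\<^sub>R grad f y) = (x - y) - \<gamma> *\<^sub>R g"
    unfolding g_def by (simp add: algebra_simps)
  then have "(norm ((x - \<gamma> *\<^sub>R grad f x) - (y - \<gamma> *\<^sub>R grad f y)))\<^sup>2 = (norm ((x - y) - \<gamma> *\<^sub>R g))\<^sup>2"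
    by (rule arg_cong)
  also have "\<dots> = (norm (x - y))\<^sup>2 - 2 * \<gamma> * inner g (x - y) + \<gamma> * (\<gamma> * (norm g)\<^sup>2)"
    unfolding norm_diff_scaleR_squared by (simp add: inner_commute power2_eq_square)
  also have "\<dots> \<le> (norm (x - y))\<^sup>2 - 2 * \<gamma> * inner g (x - y) + \<gamma> * inner g (x - y)"
    using coco assms(4) by (intro add_left_mono mult_left_mono) auto
  also have "\<dots> = (norm (x - y))\<^sup>2 - \<gamma> * inner g (x - y)"
    by simp
  also have "\<dots> \<le> (norm (x - y))\<^sup>2 - \<gamma> * (\<mu> * (norm (x - y))\<^sup>2)"
    using mono assms(4) by (intro diff_left_mono mult_left_mono) auto
  finally show ?thesis
    by (simp add: algebra_simps)
qed

subsection \<open>Subgradients and the proximity operator\<close>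

text \<open>Finiteness of \<open>\<psi> x\<close> is part of the notion so that subgradient
  inequalities can be added and cancelled as real inequalities.\<close>

definition subgrad :: "('a::real_inner \<Rightarrow> ereal) \<Rightarrow> 'a \<Rightarrow> 'a \<Rightarrow> bool" where
  "subgrad \<psi> x v \<longleftrightarrow> \<bar>\<psi> x\<bar> \<noteq> \<infinity> \<and> (\<forall>y. \<psi> x + ereal (inner v (y - x)) \<le> \<psi> y)"

lemma subgrad_monotone:
  assumes "subgrad \<psi> x u" and "subgrad \<psi> y v"
  shows "0 \<le> inner (u - v) (x - y)"
proof -
  obtain a b where ab: "\<psi> x = ereal a" "\<psi> y = ereal b"
    using assms unfolding subgrad_def by (cases "\<psi> x"; cases "\<psi> y") auto
  have "\<psi> x + ereal (inner u (y - x)) \<le> \<psi> y" "\<psi> y + ereal (inner v (x - y)) \<le> \<psi> x"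
    using assms unfolding subgrad_def by blast+
  then have "a + inner u (y - x) \<le> b" "b + inner v (x - y) \<le> a"
    unfolding ab by simp_all
  then show ?thesis
    by (simp add: inner_diff_left inner_diff_right algebra_simps)
qed

lemma convex_funD:
  assumes "convex_fun \<psi>" and "\<psi> x \<le> ereal a" and "\<psi> y \<le> ereal b" and "0 \<le> t" and "t \<le> 1"
  shows "\<psi> (t *\<^sub>R x + (1 - t) *\<^sub>R y) \<le> ereal (t * a + (1 - t) * b)"
proof -
  have "t *\<^sub>R (x, a) + (1 - t) *\<^sub>R (y, b) \<in> ext_epigraph \<psi>"
    using assms unfolding convex_fun_def
    by (intro convexD) (auto simp: ext_epigraph_def)
  then show ?thesis
    by (simp add: ext_epigraph_def)
qed

section \<open>Existence of minimizers\<close>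

lemma arg_min_le:
  fixes G :: "'a \<Rightarrow> 'b::linorder"
  assumes "\<exists>x. \<forall>y. G x \<le> G y"
  shows "G (ARG_MIN G x. True) \<le> G y"
proof -
  have "\<exists>x. is_arg_min G (\<lambda>x. True) x"
    using assms by (auto simp: is_arg_min_def not_less)
  then have "is_arg_min G (\<lambda>x. True) (ARG_MIN G x. True)"
    unfolding arg_min_def by (rule someI_ex)
  then show ?thesis
    by (auto simp: is_arg_min_def not_less)
qed

text \<open>Weierstrass for lower semicontinuous functions: sublevel sets at real levels above the
  infimum have the finite intersection property on \<open>K\<close>, and a common point attains the
  infimum, which may be infinite.\<close>

lemma compact_attains_min_if_closed_sublevels:
  fixes G :: "'a::topological_space \<Rightarrow> ereal"
  assumes "compact K" and "K \<noteq> {}" and closed: "\<And>c. closed {x. G x \<le> ereal c}"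
  shows "\<exists>x\<in>K. \<forall>y\<in>K. G x \<le> G y"
proof -
  define m where "m = (INF x\<in>K. G x)"
  define I where "I = {c. m < ereal c}"
  have "K \<inter> (\<Inter>c\<in>I. {x. G x \<le> ereal c}) \<noteq> {}"
  proof (rule compact_imp_fip_image[OF assms(1)])
    show "closed {x. G x \<le> ereal c}" for c
      by (rule closed)
  next
    fix J assume J: "finite J" "J \<subseteq> I"
    show "K \<inter> (\<Inter>c\<in>J. {x. G x \<le> ereal c}) \<noteq> {}"
    \<comment> \<open>\<open>Min {}\<close> is unspecified, so the empty family is separate; it is
      the only one when \<open>m = \<infinity>\<close>.\<close>
    proof (cases "J = {}")
      case True
      then show ?thesis using assms(2) by simp
    next
      case False
      have "m < ereal (Min J)"
        using subsetD[OF J(2) Min_in[OF J(1) False]] unfolding I_def by (rule CollectD)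
      then obtain x where "x \<in> K" "G x < ereal (Min J)"
        unfolding m_def INF_less_iff by blast
      moreover have "ereal (Min J) \<le> ereal c" if "c \<in> J" for c
        using J(1) that by simp
      ultimately have "x \<in> K \<inter> (\<Inter>c\<in>J. {x. G x \<le> ereal c})"
        by (simp add: less_imp_le less_le_trans)
      then show ?thesis
        by blast
    qed
  qed
  then obtain x where x: "x \<in> K" "\<And>c. m < ereal c \<Longrightarrow> G x \<le> ereal c"
    unfolding I_def by auto
  have "G x \<le> m"
  proof (rule ccontr)
    assume "\<not> G x \<le> m"
    then obtain c where "m < ereal c" "ereal c < G x"
      using ereal_dense2 by (metis not_le)
    then show False
      using x(2) by (meson not_le)
  qed
  then show ?thesis
    using x(1) unfolding m_def by (meson INF_lower order_trans)
qed

text \<open>Solving for \<open>\<psi> x\<close> exhibits the sublevel set as the preimage of the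
  closed epigraph under a continuous map.\<close>

lemma composite_sublevel_closed:
  fixes g :: "'a::t2_space \<Rightarrow> real"
  assumes "continuous_on UNIV g" and "closed_fun \<psi>" and "0 < \<eta>"
  shows "closed {x. ereal (g x) + ereal \<eta> * \<psi> x \<le> ereal c}"
proof -
  have "ereal (g x) + ereal \<eta> * \<psi> x \<le> ereal c \<longleftrightarrow> \<psi> x \<le> ereal ((c - g x) / \<eta>)" for x
    using assms(3) by (cases "\<psi> x") (auto simp: field_simps)
  then have "{x. ereal (g x) + ereal \<eta> * \<psi> x \<le> ereal c}
      = (\<lambda>x. (x, (c - g x) / \<eta>)) -` ext_epigraph \<psi>"
    by (auto simp: ext_epigraph_def)
  moreover have "continuous_on UNIV (\<lambda>x. (x, (c - g x) / \<eta>))"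
    using assms(1,3) by (intro continuous_intros) auto
  ultimately show ?thesis
    using closed_vimage[of "ext_epigraph \<psi>" "\<lambda>x. (x, (c - g x) / \<eta>)"] assms(2)
    unfolding closed_fun_def by simp
qed

text \<open>The minimum over a unit ball around a point \<open>x\<^sub>1\<close> of the domain bounds the objective along every
  ray from \<open>x\<^sub>1\<close>: by strong convexity it exceeds its value at \<open>x\<^sub>1\<close> outside a large ball, so that the
  minimum over that ball is global.\<close>

lemma strongly_convex_composite_has_min:
  fixes g :: "'a::euclidean_space \<Rightarrow> real"
  assumes "strongly_convex_fun \<mu> g" and "0 < \<mu>" and "continuous_on UNIV g"
    and "proper_fun \<psi>" and "closed_fun \<psi>" and "convex_fun \<psi>" and "0 < \<eta>"
  shows "\<exists>x. \<forall>y. ereal (g x) + ereal \<eta> * \<psi> x \<le> ereal (g y) + ereal \<eta> * \<psi> y"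
proof -
  define G where "G = (\<lambda>x. ereal (g x) + ereal \<eta> * \<psi> x)"
  have closed: "closed {x. G x \<le> ereal c}" for c
    unfolding G_def using assms(3,5,7) by (rule composite_sublevel_closed)
  have fin: "\<psi> x \<noteq> -\<infinity>" for x
    using assms(4) unfolding proper_fun_def by blast
  obtain x1 a where a: "\<psi> x1 = ereal a"
    using assms(4) unfolding proper_fun_def by (metis ereal_cases)
  define F where "F = g x1 + \<eta> * a"
  have F: "G x1 = ereal F"
    unfolding G_def F_def a by simp
  obtain x0 where x0: "x0 \<in> cball x1 1" "\<And>y. y \<in> cball x1 1 \<Longrightarrow> G x0 \<le> G y"
    using compact_attains_min_if_closed_sublevels[OF compact_cball _ closed, of x1 1] by auto
  have "G x0 \<le> ereal F"
    using x0(2)[of x1] F by simp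
  then obtain m where m: "G x0 = ereal m"
    using fin[of x0] assms(7) unfolding G_def by (cases "\<psi> x0") auto
  \<comment> \<open>For \<open>r\<close> the distance from \<open>x1\<close>, the second bound is
    equivalent to \<open>F - m < \<mu> / 2 * (r - 1)\<close>, where the right side is the strong
    convexity gain on the ray; the bound 1 keeps \<open>t = 1 / r\<close> below 1.\<close>
  define R where "R = max 1 (1 + 2 * (F - m) / \<mu>)"
  have far: "ereal F \<le> G y" if "R < norm (y - x1)" for y
  proof (cases "\<psi> y")
    case PInf
    then show ?thesis
      unfolding G_def using assms(7) by simp
  next
    case MInf
    then show ?thesis
      using fin by blast
  next
    case (real b)
    define r where "r = norm (y - x1)"
    have r: "1 < r" "1 + 2 * (F - m) / \<mu> < r"
      using that unfolding R_def r_def by auto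
    define t where "t = 1 / r"
    have t: "0 < t" "t < 1" "t * r = 1"
      using r unfolding t_def by auto
    \<comment> \<open>This point of the segment has distance exactly 1 from \<open>x1\<close>, so
      \<open>m\<close> bounds the objective there from below.\<close>
    define z where "z = t *\<^sub>R y + (1 - t) *\<^sub>R x1"
    have "z - x1 = t *\<^sub>R (y - x1)"
      unfolding z_def by (simp add: algebra_simps)
    then have "norm (z - x1) = t * r"
      using t(1) unfolding r_def by simp
    then have "z \<in> cball x1 1"
      using t(3) by (simp add: dist_norm norm_minus_commute)
    then have "ereal m \<le> G z"
      using x0(2) m by metis
    moreover have "G z \<le> ereal (t * g y + (1 - t) * g x1 - \<mu> / 2 * t * (1 - t) * r\<^sup>2)
        + ereal \<eta> * ereal (t * b + (1 - t) * a)"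
      unfolding G_def
    proof (intro add_mono ereal_mult_left_mono)
      show "ereal (g z) \<le> ereal (t * g y + (1 - t) * g x1 - \<mu> / 2 * t * (1 - t) * r\<^sup>2)"
        using assms(1) t unfolding strongly_convex_fun_def z_def r_def by simp
      show "\<psi> z \<le> ereal (t * b + (1 - t) * a)"
        unfolding z_def using assms(6) real a t by (intro convex_funD) auto
    qed (use assms(7) in simp)
    ultimately have "ereal m \<le> ereal (t * g y + (1 - t) * g x1 - \<mu> / 2 * t * (1 - t) * r\<^sup>2)
        + ereal \<eta> * ereal (t * b + (1 - t) * a)"
      by (rule order_trans)
    then have "m \<le> t * g y + (1 - t) * g x1 - \<mu> / 2 * t * (1 - t) * r\<^sup>2 + \<eta> * (t * b + (1 - t) * a)"
      by simp
    then have "m \<le> t * (g y + \<eta> * b) + (1 - t) * F - \<mu> / 2 * t * (1 - t) * r\<^sup>2"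
      unfolding F_def by (simp add: algebra_simps)
    moreover have "\<mu> / 2 * t * (1 - t) * r\<^sup>2 = \<mu> / 2 * (t * r) * (r - t * r)"
      by (simp add: power2_eq_square algebra_simps)
    moreover have "F - m < \<mu> / 2 * (r - 1)"
      using r(2) assms(2) by (simp add: field_simps)
    ultimately have "t * F < t * (g y + \<eta> * b)"
      unfolding t(3) left_diff_distrib[of 1 t F] by linarith
    then have "F < g y + \<eta> * b"
      using t(1) by simp
    then show ?thesis
      unfolding G_def real by simp
  qed
  have R: "x1 \<in> cball x1 R"
    unfolding R_def by simp
  then obtain x where x: "\<And>y. y \<in> cball x1 R \<Longrightarrow> G x \<le> G y"
    using compact_attains_min_if_closed_sublevels[OF compact_cball _ closed, of x1 R] by blast
  have "G x \<le> G y" for y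
  proof (cases "y \<in> cball x1 R")
    case True
    then show ?thesis by (rule x)
  next
    case False
    then have "ereal F \<le> G y"
      by (intro far) (simp add: dist_norm norm_minus_commute)
    then show ?thesis
      using x[OF R] F by simp
  qed
  then show ?thesis
    unfolding G_def by blast
qed

section \<open>Optimality conditions\<close>

text \<open>Fermat's rule: minimality is tested against points of the segment from \<open>x\<close>
  to \<open>y\<close>. Convexity makes the change of \<open>\<psi>\<close> at most linear in
  \<open>t\<close>, so dividing by \<open>t\<close> and letting \<open>t\<close> tend to 0 leaves
  only the derivative of \<open>g\<close>.\<close>

lemma composite_min_subgrad:
  fixes g :: "'a::real_inner \<Rightarrow> real"
  assumes "GDERIV g x :> d" and "proper_fun \<psi>" and "convex_fun \<psi>" and "0 < \<eta>"
    and min: "\<And>y. ereal (g x) + ereal \<eta> * \<psi> x \<le> ereal (g y) + ereal \<eta> * \<psi> y"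
  shows "subgrad \<psi> x (- (1 / \<eta>) *\<^sub>R d)"
proof -
  have fin: "\<psi> y \<noteq> -\<infinity>" for y
    using assms(2) unfolding proper_fun_def by blast
  obtain x1 a1 where a1: "\<psi> x1 = ereal a1"
    using assms(2) unfolding proper_fun_def by (metis ereal_cases)
  obtain a where a: "\<psi> x = ereal a"
    using min[of x1] a1 fin[of x] assms(4) by (cases "\<psi> x") auto
  have "\<psi> x + ereal (inner (- (1 / \<eta>) *\<^sub>R d) (y - x)) \<le> \<psi> y" for y
  proof (cases "\<psi> y")
    case PInf
    then show ?thesis by simp
  next
    case MInf
    then show ?thesis using fin by blast
  next
    case (real b)
    let ?q = "\<lambda>t. (g (x + t *\<^sub>R (y - x)) - g x) / t"
    have "eventually (\<lambda>t. t \<in> {0<..<1::real}) (at_right 0)"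
      by (rule eventually_at_right_real) simp
    then have "eventually (\<lambda>t. \<eta> * (a - b) \<le> ?q t) (at_right 0)"
    proof eventually_elim
      case (elim t)
      define z where "z = t *\<^sub>R y + (1 - t) *\<^sub>R x"
      have z: "z = x + t *\<^sub>R (y - x)"
        unfolding z_def by (simp add: algebra_simps)
      have "\<psi> z \<le> ereal (t * b + (1 - t) * a)"
        unfolding z_def using assms(3) real a elim by (intro convex_funD) auto
      then have "ereal (g z) + ereal \<eta> * \<psi> z \<le> ereal (g z) + ereal \<eta> * ereal (t * b + (1 - t) * a)"
        using assms(4) by (intro add_left_mono ereal_mult_left_mono) auto
      then have "ereal (g x) + ereal \<eta> * \<psi> x \<le> ereal (g z) + ereal \<eta> * ereal (t * b + (1 - t) * a)"
        using min[of z] by (rule order_trans[rotated])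
      then have "g x + \<eta> * a \<le> g z + \<eta> * (t * b + (1 - t) * a)"
        using a by simp
      then have "\<eta> * (a - b) * t \<le> g z - g x"
        by (simp add: algebra_simps)
      then show ?case
        using elim unfolding z by (simp add: pos_le_divide_eq)
    qed
    then have "\<eta> * (a - b) \<le> inner d (y - x)"
      by (intro tendsto_lowerbound[OF GDERIV_quotient_tendsto[OF assms(1)]]) auto
    then have "a - b \<le> inner d (y - x) / \<eta>"
      using assms(4) by (simp add: pos_le_divide_eq mult.commute)
    then show ?thesis
      using a real by simp
  qed
  then show ?thesis
    using a unfolding subgrad_def by simp
qed

text \<open>For half the squared distance, strong convexity with modulus 1 holds with
  equality.\<close>

lemma strongly_convex_half_norm_square:
  "strongly_convex_fun 1 (\<lambda>y::'a::real_inner. 1 / 2 * (norm (y - x))\<^sup>2)"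
proof -
  have "(norm (t *\<^sub>R a + (1 - t) *\<^sub>R b))\<^sup>2
      = t * (norm a)\<^sup>2 + (1 - t) * (norm b)\<^sup>2 - t * (1 - t) * (norm (a - b))\<^sup>2" for t and a b :: 'a
    unfolding power2_norm_eq_inner
    by (simp add: inner_add_left inner_add_right inner_diff_left inner_diff_right
        inner_commute[of b a] algebra_simps)
  moreover have "t *\<^sub>R y + (1 - t) *\<^sub>R z - x = t *\<^sub>R (y - x) + (1 - t) *\<^sub>R (z - x)" for t and y z :: 'a
    by (simp add: algebra_simps)
  moreover have "y - z = (y - x) - (z - x)" for y z :: 'a
    by simp
  ultimately have "(norm (t *\<^sub>R y + (1 - t) *\<^sub>R z - x))\<^sup>2
      = t * (norm (y - x))\<^sup>2 + (1 - t) * (norm (z - x))\<^sup>2 - t * (1 - t) * (norm (y - z))\<^sup>2"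
    for t and y z :: 'a
    by metis
  then show ?thesis
    unfolding strongly_convex_fun_def by (simp add: diff_divide_distrib add_divide_distrib)
qed

lemma GDERIV_half_norm_square:
  "GDERIV (\<lambda>y::'a::real_inner. 1 / 2 * (norm (y - x))\<^sup>2) y :> y - x"
  unfolding gderiv_def power2_norm_eq_inner
  by (auto intro!: derivative_eq_intros simp: inner_commute)

text \<open>The smooth part of the prox objective is strongly convex, so the choice in
  \<open>prox\<close> is a true minimizer; Fermat's rule applies with gradient
  \<open>prox \<eta> \<psi> x - x\<close>.\<close>

lemma prox_subgrad:
  fixes \<psi> :: "'a::euclidean_space \<Rightarrow> ereal"
  assumes "proper_fun \<psi>" and "closed_fun \<psi>" and "convex_fun \<psi>" and "0 < \<eta>"
  shows "subgrad \<psi> (prox \<eta> \<psi> x) ((1 / \<eta>) *\<^sub>R (x - prox \<eta> \<psi> x))"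
proof -
  have "continuous_on UNIV (\<lambda>y::'a. 1 / 2 * (norm (y - x))\<^sup>2)"
    by (intro continuous_intros)
  from strongly_convex_composite_has_min[OF strongly_convex_half_norm_square _ this assms]
  have "subgrad \<psi> (prox \<eta> \<psi> x) (- (1 / \<eta>) *\<^sub>R (prox \<eta> \<psi> x - x))"
    by (intro composite_min_subgrad[OF GDERIV_half_norm_square assms(1,3,4)])
      (unfold prox_def, intro arg_min_le, simp)
  then show ?thesis
    by (simp add: algebra_simps)
qed

subsection \<open>The ProxSkip iteration\<close>

lemma proxskip_prox_step_bound:
  fixes f :: "'a::euclidean_space \<Rightarrow> real"
  assumes "proper_fun \<psi>" and "closed_fun \<psi>" and "convex_fun \<psi>" and "0 < \<gamma>" and "0 < p"
    and star: "subgrad \<psi> xstar (- hstar)"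
  shows "lyapunov \<gamma> p xstar hstar (proxskip_step f \<psi> \<gamma> p True (x, h))
    \<le> (norm ((x - \<gamma> *\<^sub>R (grad f x - h) - xstar) - (\<gamma> / p) *\<^sub>R (h - hstar)))\<^sup>2"
proof -
  define xhat where "xhat = x - \<gamma> *\<^sub>R (grad f x - h)"
  define x' where "x' = prox (\<gamma> / p) \<psi> (xhat - (\<gamma> / p) *\<^sub>R h)"
  define h' where "h' = h + (p / \<gamma>) *\<^sub>R (x' - xhat)"
  define c where "c = \<gamma> / p"
  have c: "0 < c" "p / \<gamma> = 1 / c"
    using assms(4,5) unfolding c_def by auto
  have h': "c *\<^sub>R h' = c *\<^sub>R h + (x' - xhat)"
    unfolding h'_def c(2) using c(1) by (simp add: algebra_simps)
  have "subgrad \<psi> x' ((1 / c) *\<^sub>R ((xhat - c *\<^sub>R h) - x'))"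
    unfolding x'_def c_def[symmetric] using assms(1-3) c(1) by (rule prox_subgrad)
  \<comment> \<open>The update of \<open>h\<close> is designed for this: the new control vector is
    the negative of the subgradient supplied by the prox.\<close>
  moreover have "(1 / c) *\<^sub>R ((xhat - c *\<^sub>R h) - x') = - h'"
    unfolding h'_def c(2) using c(1) by (simp add: algebra_simps)
  ultimately have "0 \<le> inner (- h' - - hstar) (x' - xstar)"
    using star by (metis subgrad_monotone)
  then have "inner (x' - xstar) (h' - hstar) \<le> 0"
    by (simp add: inner_diff_left inner_diff_right inner_commute)
  \<comment> \<open>The cross term has the right sign to be added for free, which completes the
    square.\<close>
  then have "(norm (x' - xstar))\<^sup>2 + c\<^sup>2 * (norm (h' - hstar))\<^sup>2
      \<le> (norm (x' - xstar))\<^sup>2 + c\<^sup>2 * (norm (h' - hstar))\<^sup>2 - 2 * c * inner (x' - xstar) (h' - hstar)"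
    using c(1) by (simp add: mult_nonneg_nonpos)
  also have "\<dots> = (norm ((x' - xstar) - c *\<^sub>R (h' - hstar)))\<^sup>2"
    by (simp add: norm_diff_scaleR_squared)
  \<comment> \<open>The update keeps \<open>x' - c *\<^sub>R h'\<close> equal to
    \<open>xhat - c *\<^sub>R h\<close>, so the prox point disappears from the bound.\<close>
  also have "(x' - xstar) - c *\<^sub>R (h' - hstar) = (xhat - xstar) - c *\<^sub>R (h - hstar)"
    using h' by (simp add: algebra_simps)
  finally show ?thesis
    by (simp add: lyapunov_def proxskip_step_def Let_def xhat_def x'_def h'_def c_def power_divide)
qed

text \<open>The state \<open>s\<close> is fixed, so the conditional expectation over the next coin
  is just a weighted sum and the argument stays deterministic.\<close>

lemma proxskip_step_expected_decrease:
  fixes f :: "'a::euclidean_space \<Rightarrow> real"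
  assumes "smooth_fun L f" and "0 \<le> \<mu>" and "strongly_convex_fun \<mu> f"
    and "proper_fun \<psi>" and "closed_fun \<psi>" and "convex_fun \<psi>"
    and "subgrad \<psi> xstar (- grad f xstar)"
    and "0 < \<gamma>" and "\<gamma> \<le> 1 / L" and "0 < p" and "p \<le> 1"
  defines "V \<equiv> lyapunov \<gamma> p xstar (grad f xstar)"
  shows "p * V (proxskip_step f \<psi> \<gamma> p True s) + (1 - p) * V (proxskip_step f \<psi> \<gamma> p False s)
    \<le> (1 - min (\<gamma> * \<mu>) (p\<^sup>2)) * V s"
proof -
  obtain x h where s: "s = (x, h)"
    by (cases s)
  define X where "X = x - \<gamma> *\<^sub>R (grad f x - h) - xstar"
  define H where "H = h - grad f xstar"
  define c where "c = \<gamma> / p"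
  define W where "W = c\<^sup>2 * (norm H)\<^sup>2"
  have cp: "c * p = \<gamma>"
    using assms(10) unfolding c_def by simp
  have V: "V s = (norm (x - xstar))\<^sup>2 + W"
    unfolding s V_def W_def H_def c_def by (simp add: lyapunov_def power_divide)
  have T: "V (proxskip_step f \<psi> \<gamma> p True s) \<le> (norm (X - c *\<^sub>R H))\<^sup>2"
    unfolding s V_def X_def H_def c_def using assms(4-6,8,10,7) by (rule proxskip_prox_step_bound)
  have F: "V (proxskip_step f \<psi> \<gamma> p False s) = (norm X)\<^sup>2 + W"
    unfolding s V_def W_def X_def H_def c_def
    by (simp add: lyapunov_def proxskip_step_def Let_def power_divide)
  have "X - \<gamma> *\<^sub>R H = (x - \<gamma> *\<^sub>R grad f x) - (xstar - \<gamma> *\<^sub>R grad f xstar)"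
    unfolding X_def H_def by (simp add: algebra_simps)
  then have contr: "(norm (X - \<gamma> *\<^sub>R H))\<^sup>2 \<le> (1 - \<gamma> * \<mu>) * (norm (x - xstar))\<^sup>2"
    using gradient_step_contraction[OF assms(1,3,2,8,9)] by simp
  have "p * V (proxskip_step f \<psi> \<gamma> p True s) + (1 - p) * V (proxskip_step f \<psi> \<gamma> p False s)
      \<le> p * (norm (X - c *\<^sub>R H))\<^sup>2 + (1 - p) * ((norm X)\<^sup>2 + W)"
    unfolding F using T assms(10) by simp
  also have "\<dots> = (norm X)\<^sup>2 - 2 * (c * p) * inner X H + W"
    unfolding norm_diff_scaleR_squared W_def by (simp add: algebra_simps)
  \<comment> \<open>Because \<open>c * p = \<gamma>\<close>, the cross term is the one of this
    square; completing it costs \<open>\<gamma>\<^sup>2 * (norm H)\<^sup>2\<close>, which is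
    \<open>p\<^sup>2 * W\<close>.\<close>
  also have "\<dots> = (norm (X - \<gamma> *\<^sub>R H))\<^sup>2 + (1 - p\<^sup>2) * W"
    unfolding norm_diff_scaleR_squared W_def cp[symmetric] by (simp add: algebra_simps power2_eq_square)
  also have "\<dots> \<le> (1 - \<gamma> * \<mu>) * (norm (x - xstar))\<^sup>2 + (1 - p\<^sup>2) * W"
    using contr by simp
  also have "\<dots> \<le> (1 - min (\<gamma> * \<mu>) (p\<^sup>2)) * (norm (x - xstar))\<^sup>2 + (1 - min (\<gamma> * \<mu>) (p\<^sup>2)) * W"
    unfolding W_def by (intro add_mono mult_right_mono) auto
  finally show ?thesis
    unfolding V by (simp add: distrib_left)
qed

section \<open>Dependence on the coin flips\<close>

text \<open>This causality is what makes the state at time \<open>t\<close> independent of coin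
  \<open>t\<close>.\<close>

lemma proxskip_cong:
  assumes "\<And>s. s < t \<Longrightarrow> c s = c' s"
  shows "proxskip f \<psi> \<gamma> p x0 h0 c t = proxskip f \<psi> \<gamma> p x0 h0 c' t"
  using assms by (induction t) auto

text \<open>\<open>g\<close> factors through the first \<open>T\<close> coins, that is, through a
  finite discrete space on which every real function is measurable and bounded. Restricting the
  coins to the disjoint index sets \<open>{..<T}\<close> and \<open>{T}\<close> gives independence,
  hence the product of expectations.\<close>

lemma (in prob_space)
  fixes \<theta> :: "nat \<Rightarrow> 'a \<Rightarrow> bool" and g :: "(nat \<Rightarrow> bool) \<Rightarrow> real"
  assumes ind: "indep_vars (\<lambda>_. count_space UNIV) \<theta> UNIV"
    and g: "\<And>c c'. (\<And>s. s < T \<Longrightarrow> c s = c' s) \<Longrightarrow> g c = g c'"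
  shows integrable_finitely_many_coins: "integrable M (\<lambda>\<omega>. g (\<lambda>s. \<theta> s \<omega>))" (is ?int)
    and expectation_next_coin_times:
      "expectation (\<lambda>\<omega>. g (\<lambda>s. \<theta> s \<omega>) * of_bool (\<theta> T \<omega>))
        = expectation (\<lambda>\<omega>. g (\<lambda>s. \<theta> s \<omega>)) * prob {\<omega> \<in> space M. \<theta> T \<omega>}" (is ?exp)
proof -
  let ?N = "\<lambda>A. PiM A (\<lambda>_. count_space (UNIV :: bool set)) :: (nat \<Rightarrow> bool) measure"
  let ?R = "\<lambda>A \<omega>. restrict (\<lambda>i. \<theta> i \<omega>) A"
  have N: "?N A = count_space (PiE A (\<lambda>_. UNIV))" if "finite A" for A
    using that by (intro count_space_PiM_finite) auto
  have meas: "k \<in> borel_measurable (?N A)" if "finite A" for A and k :: "(nat \<Rightarrow> bool) \<Rightarrow> real"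
    unfolding N[OF that] by simp
  have rv: "\<theta> s \<in> measurable M (count_space UNIV)" for s
    using ind unfolding indep_vars_def by auto
  have gR: "g (\<lambda>s. \<theta> s \<omega>) = g (?R {..<T} \<omega>)" for \<omega>
    by (rule g) simp
  have R: "?R A \<in> measurable M (?N A)" for A
    using rv by (intro measurable_restrict)
  have gmeas: "(\<lambda>\<omega>. g (\<lambda>s. \<theta> s \<omega>)) \<in> borel_measurable M"
    unfolding gR using R meas by (rule measurable_compose) simp
  define B where "B = Max ((\<lambda>c. \<bar>g c\<bar>) ` PiE {..<T} (\<lambda>_. UNIV))"
  have "\<bar>g (\<lambda>s. \<theta> s \<omega>)\<bar> \<le> B" for \<omega>
    unfolding gR B_def by (intro Max_ge finite_imageI finite_PiE imageI) auto
  then show int: ?int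
    using gmeas by (intro integrable_const_bound[of _ B]) auto
  have "indep_var (?N {..<T}) (?R {..<T}) (?N {T}) (?R {T})"
    using ind by (rule indep_var_restrict) auto
  then have "indep_var borel (g \<circ> ?R {..<T}) borel ((\<lambda>c. of_bool (c T) :: real) \<circ> ?R {T})"
    by (rule indep_var_compose) (auto intro: meas)
  then have iv: "indep_var borel (\<lambda>\<omega>. g (\<lambda>s. \<theta> s \<omega>)) borel (\<lambda>\<omega>. of_bool (\<theta> T \<omega>) :: real)"
    unfolding gR by (simp add: comp_def)
  have ev: "{\<omega> \<in> space M. \<theta> T \<omega>} \<in> events"
    using measurable_sets[OF rv, of "{True}" T] by (simp add: vimage_def Int_def conj_commute)
  have ind_eq: "of_bool (\<theta> T \<omega>) = indicat_real {\<omega> \<in> space M. \<theta> T \<omega>} \<omega>" if "\<omega> \<in> space M" for \<omega>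
    using that by (simp add: indicator_def)
  have coin: "integrable M (\<lambda>\<omega>. of_bool (\<theta> T \<omega>) :: real)"
      "expectation (\<lambda>\<omega>. of_bool (\<theta> T \<omega>)) = prob {\<omega> \<in> space M. \<theta> T \<omega>}"
    using ev
    by (simp_all add: ind_eq emeasure_eq_measure
        cong: Bochner_Integration.integrable_cong Bochner_Integration.integral_cong)
  show ?exp
    using indep_var_lebesgue_integral[OF iv int coin(1)] coin(2) by simp
qed

section \<open>Convergence in expectation\<close>

theorem theorem3p6:
  fixes f :: "real ^ 'd \<Rightarrow> real" and \<psi> :: "real ^ 'd \<Rightarrow> ereal"
    and L \<mu> \<gamma> p \<zeta> :: real
    and xstar hstar x0 h0 :: "real ^ 'd"
    and M :: "'w measure" and \<theta> :: "nat \<Rightarrow> 'w \<Rightarrow> bool"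
    and \<Psi> :: "nat \<Rightarrow> 'w \<Rightarrow> real" and T :: nat
  assumes "smooth_fun L f" and "\<mu> > 0" and "strongly_convex_fun \<mu> f"
    and "proper_fun \<psi>" and "closed_fun \<psi>" and "convex_fun \<psi>"
    and "xstar = (ARG_MIN (\<lambda>x. ereal (f x) + \<psi> x) x. True)"
    and "hstar = grad f xstar"
    and "0 < \<gamma>" and "\<gamma> \<le> 1 / L" and "0 < p" and "p \<le> 1"
    and "prob_space M"
    and "prob_space.indep_vars M (\<lambda>_. count_space UNIV) \<theta> UNIV"
    and "\<And>t. measure M {\<omega> \<in> space M. \<theta> t \<omega>} = p"
    and "\<And>t \<omega>. \<Psi> t \<omega> = lyapunov \<gamma> p xstar hstar (proxskip f \<psi> \<gamma> p x0 h0 (\<lambda>s. \<theta> s \<omega>) t)"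
    and "\<zeta> = min (\<gamma> * \<mu>) (p\<^sup>2)"
    and "T \<ge> 1"
  shows "integrable M (\<Psi> T) \<and>
         (\<integral>\<omega>. \<Psi> T \<omega> \<partial>M) \<le> (1 - \<zeta>) ^ T * lyapunov \<gamma> p xstar hstar (x0, h0)"
proof -
  interpret prob_space M
    by fact
  let ?V = "lyapunov \<gamma> p xstar hstar"
  let ?S = "\<lambda>t c. proxskip f \<psi> \<gamma> p x0 h0 c t"
  let ?A = "\<lambda>t c. ?V (proxskip_step f \<psi> \<gamma> p True (?S t c))"
  let ?B = "\<lambda>t c. ?V (proxskip_step f \<psi> \<gamma> p False (?S t c))"
  have diff: "f differentiable (at x)" for x
    using assms(1) unfolding smooth_fun_def by blast
  then have cont: "continuous_on UNIV f"
    by (simp add: continuous_on_eq_continuous_at differentiable_imp_continuous_within)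
  \<comment> \<open>The factor \<open>ereal 1\<close> matches the composite lemmas at
    \<open>\<eta> = 1\<close>.\<close>
  have "ereal (f xstar) + ereal 1 * \<psi> xstar \<le> ereal (f y) + ereal 1 * \<psi> y" for y
  proof -
    have "\<exists>x. \<forall>y. ereal (f x) + \<psi> x \<le> ereal (f y) + \<psi> y"
      using strongly_convex_composite_has_min[OF assms(3,2) cont assms(4-6), of 1]
      by (simp flip: one_ereal_def)
    then have "ereal (f xstar) + \<psi> xstar \<le> ereal (f y) + \<psi> y"
      unfolding assms(7) by (rule arg_min_le)
    then show ?thesis
      by (simp flip: one_ereal_def)
  qed
  from composite_min_subgrad[OF GDERIV_grad[OF diff] assms(4,6) _ this]
  have star: "subgrad \<psi> xstar (- grad f xstar)"
    by simp
  have decrease: "p * ?A t c + (1 - p) * ?B t c \<le> (1 - \<zeta>) * ?V (?S t c)" for t c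
    unfolding assms(8,17)
    using assms(1) less_imp_le[OF assms(2)] assms(3-6) star assms(9-12)
    by (rule proxskip_step_expected_decrease)
  have S_cong: "F (?S t c) = F (?S t c')" if "\<And>s. s < t \<Longrightarrow> c s = c' s"
    for F :: "_ \<Rightarrow> real" and t c c'
    using proxskip_cong[OF that] by (rule arg_cong)
  note coins = integrable_finitely_many_coins[OF assms(14)]
    expectation_next_coin_times[OF assms(14), unfolded assms(15)]
  have int: "integrable M (\<Psi> t)" for t
  proof -
    have "integrable M (\<lambda>\<omega>. ?V (?S t (\<lambda>s. \<theta> s \<omega>)))"
      by (rule coins(1)[where T = t], rule S_cong[of _ _ _ ?V])
    then show ?thesis
      by (simp add: assms(16)[abs_def])
  qed
  have step: "expectation (\<Psi> (Suc t)) \<le> (1 - \<zeta>) * expectation (\<Psi> t)" for t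
  proof -
    let ?a = "\<lambda>\<omega>. ?A t (\<lambda>s. \<theta> s \<omega>)" and ?b = "\<lambda>\<omega>. ?B t (\<lambda>s. \<theta> s \<omega>)"
    let ?d = "\<lambda>x. ?V (proxskip_step f \<psi> \<gamma> p True x) - ?V (proxskip_step f \<psi> \<gamma> p False x)"
    have "integrable M (\<lambda>\<omega>. ?V (proxskip_step f \<psi> \<gamma> p b (?S t (\<lambda>s. \<theta> s \<omega>))))" for b
      by (rule coins(1)[where T = t],
          rule S_cong[of _ _ _ "\<lambda>x. ?V (proxskip_step f \<psi> \<gamma> p b x)"])
    then have int_ab: "integrable M ?a" "integrable M ?b"
      by blast+
    \<comment> \<open>This product also reads coin \<open>t\<close>, hence the cutoff
      \<open>Suc t\<close> instead of \<open>t\<close>.\<close>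
    have "integrable M (\<lambda>\<omega>. (?a \<omega> - ?b \<omega>) * of_bool (\<theta> t \<omega>))"
      by (rule coins(1)[where T = "Suc t" and g = "\<lambda>c. ?d (?S t c) * of_bool (c t)"],
          intro arg_cong2[where f = "(*)"] S_cong[of _ _ _ ?d]) auto
    \<comment> \<open>Writing the branch as a linear expression in coin \<open>t\<close> separates
      it from the factors \<open>?a\<close> and \<open>?b\<close>, which depend only on earlier
      coins.\<close>
    moreover have "\<Psi> (Suc t) = (\<lambda>\<omega>. ?b \<omega> + (?a \<omega> - ?b \<omega>) * of_bool (\<theta> t \<omega>))"
      by (auto simp: assms(16) fun_eq_iff)
    ultimately have "expectation (\<Psi> (Suc t))
        = expectation ?b + expectation (\<lambda>\<omega>. (?a \<omega> - ?b \<omega>) * of_bool (\<theta> t \<omega>))"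
      using int_ab(2) by simp
    also have "expectation (\<lambda>\<omega>. (?a \<omega> - ?b \<omega>) * of_bool (\<theta> t \<omega>))
        = expectation (\<lambda>\<omega>. ?a \<omega> - ?b \<omega>) * p"
      by (rule coins(2)[where g = "\<lambda>c. ?d (?S t c)"], rule S_cong[of _ _ _ ?d])
    also have "expectation ?b + \<dots> = expectation (\<lambda>\<omega>. p * ?a \<omega> + (1 - p) * ?b \<omega>)"
      using int_ab by (simp add: algebra_simps)
    also have "\<dots> \<le> expectation (\<lambda>\<omega>. (1 - \<zeta>) * \<Psi> t \<omega>)"
    proof (rule integral_mono)
      show "integrable M (\<lambda>\<omega>. p * ?a \<omega> + (1 - p) * ?b \<omega>)"
        using int_ab by simp
      show "integrable M (\<lambda>\<omega>. (1 - \<zeta>) * \<Psi> t \<omega>)"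
        using int by simp
      show "p * ?a \<omega> + (1 - p) * ?b \<omega> \<le> (1 - \<zeta>) * \<Psi> t \<omega>" for \<omega>
        unfolding assms(16) by (rule decrease)
    qed
    finally show ?thesis
      by simp
  qed
  \<comment> \<open>The induction multiplies an inequality by \<open>1 - \<zeta>\<close>, which must
    be nonnegative; \<open>p\<^sup>2 \<le> 1\<close> ensures this.\<close>
  have "\<zeta> \<le> 1"
    using assms(11,12,17) power_le_one[of p 2] by linarith
  have "expectation (\<Psi> t) \<le> (1 - \<zeta>) ^ t * ?V (x0, h0)" for t
  proof (induction t)
    case 0
    have "\<Psi> 0 = (\<lambda>_. ?V (x0, h0))"
      by (simp add: assms(16) fun_eq_iff)
    then show ?case
      by (simp add: prob_space)
  next
    case (Suc t)
    have "expectation (\<Psi> (Suc t)) \<le> (1 - \<zeta>) * expectation (\<Psi> t)"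
      by (rule step)
    also have "\<dots> \<le> (1 - \<zeta>) * ((1 - \<zeta>) ^ t * ?V (x0, h0))"
      using Suc \<open>\<zeta> \<le> 1\<close> by (intro mult_left_mono) auto
    finally show ?case
      by (simp add: mult.assoc)
  qed
  with int show ?thesis
    by blast
qed

end
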